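(* Let $M=(E,r)$ be a $q$-matroid and let $\mathbf{0}=V_0<V_1<\dots<V_k=E$ be a chain of subspaces. Let $M_i=M[V_{i-1},V_i]$ for $i=1,\dots,k$. Choose subspaces $E_i$ with $V_i=V_{i-1}\oplus E_i$, so that $E=E_1\oplus\dots\oplus E_k$, and view $M_i$ as a $q$-matroid on $E_i\cong V_i/V_{i-1}$, so that $M_1\square\cdots\square M_k$ is a $q$-matroid on $E$. Then the identity map on $E$ is a weak map from $M_1\square\cdots\square M_k$ to $M$; that is, writing $r_\square$ for the rank function of $M_1\square\cdots\square M_k$, $r_\square(X)\ge r(X)$ for every $X\in\mathcal{L}(E)$.
   Context: For a finite-dimensional $\mathbb{F}_q$-space $E$, $\mathcal{L}(E)$ is its subspace lattice and $\mathbf{0}$ the zero space. A $q$-matroid $M=(E,r)$ is given by $r:\mathcal{L}(E)\to\mathbb{Z}$ with (R1) $0\le r(A)\le\dim(A)$; (R2) $A\le B\Rightarrow r(A)\le r(B)$; (R3) $r(A+B)+r(A\cap B)\le r(A)+r(B)$. $A$ is independent if $r(A)=\dim A$. For $A\le B\le E$, the minor $M[A,B]$ is the $q$-matroid on $B/A$ (equivalently, on the interval $[A,B]$ of $\mathcal{L}(E)$) with rank function $X/A\mapsto r(X)-r(A)$ for $A\le X\le B$. A weak map from $(E_1,r_1)$ to $(E_2,r_2)$ is a function $\tau:\mathcal{L}(E_1)\to\mathcal{L}(E_2)$ with $r_1(X)\ge r_2(\tau(X))$ for all $X\in\mathcal{L}(E_1)$. Free product: for $q$-matroids $M_i=(E_i,r_i)$,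 $i=1,2$, with projections $\pi_i:E_1\oplus E_2\to E_i$ and embeddings $\iota_i:E_i\to E_1\oplus E_2$, put $\lambda_1(A)=r_1(E_1)-r_1(A)$ and $\nu_2(B)=\dim(B)-r_2(B)$. $M_1\square M_2$ is the $q$-matroid on $E_1\oplus E_2$ whose independent spaces are exactly the $I\le E_1\oplus E_2$ with $\pi_1(I\cap\iota_1(E_1))$ independent in $M_1$ and $\lambda_1(\pi_1(I\cap\iota_1(E_1)))\ge\nu_2(\pi_2(I))$. This operation is associative, so $M_1\square\cdots\square M_k$ is well defined on $E_1\oplus\cdots\oplus E_k$. *)

theory Defs
  imports Complex_Main "HOL-Library.FuncSet" "HOL-Library.Set_Algebras"
begin

text \<open>
  All spaces are subspaces of one ambient vector space, and \<open>A + B\<close> on sets is the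
  elementwise sum. A q-matroid \<open>(E, r)\<close> is a finite-dimensional subspace together with a rank
  function; the values of \<open>r\<close> outside the subspace lattice of \<open>E\<close> carry no meaning.
\<close>

type_synonym 'v qmat = "'v set \<times> ('v set \<Rightarrow> int)"

locale fq_space = vector_space scale
  for scale :: "'f::{field,finite} \<Rightarrow> 'v::ab_group_add \<Rightarrow> 'v"
begin

definition subspaces :: "'v set \<Rightarrow> 'v set set" where
  "subspaces E = {A. subspace A \<and> A \<subseteq> E}"

fun qmatroid :: "'v qmat \<Rightarrow> bool" where
  "qmatroid (E, r) \<longleftrightarrow>
     subspace E \<and> (\<exists>B. finite B \<and> span B = E) \<and>
     (\<forall>A\<in>subspaces E. 0 \<le> r A \<and> r A \<le> int (dim A)) \<and>
     (\<forall>A\<in>subspaces E. \<forall>B\<in>subspaces E. A \<subseteq> B \<longrightarrow> r A \<le> r B) \<and>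
     (\<forall>A\<in>subspaces E. \<forall>B\<in>subspaces E. r (A + B) + r (A \<inter> B) \<le> r A + r B)"

fun indep :: "'v qmat \<Rightarrow> 'v set \<Rightarrow> bool" where
  "indep (E, r) A \<longleftrightarrow> A \<in> subspaces E \<and> r A = int (dim A)"

definition direct_sum :: "'v set \<Rightarrow> 'v set \<Rightarrow> 'v set \<Rightarrow> bool" where
  "direct_sum W A B \<longleftrightarrow>
     subspace A \<and> subspace B \<and> A \<inter> B = {0} \<and> W = A + B"

text \<open>The projection of \<open>A \<oplus> B\<close> onto \<open>B\<close> along \<open>A\<close>.\<close>

definition proj :: "'v set \<Rightarrow> 'v set \<Rightarrow> 'v \<Rightarrow> 'v" where
  "proj A B x = (THE b. b \<in> B \<and> x - b \<in> A)"

text \<open>The rank function of \<open>M[A,B]\<close>, as a function on the interval from \<open>A\<close> to \<open>B\<close>.\<close>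

fun minor_rank :: "'v qmat \<Rightarrow> 'v set \<Rightarrow> 'v set \<Rightarrow> 'v set \<Rightarrow> int" where
  "minor_rank (E, r) A B = (\<lambda>X\<in>{X \<in> subspaces B. A \<subseteq> X}. r X - r A)"

text \<open>
  \<open>M[A,B]\<close> transported to a complement \<open>C\<close> of \<open>A\<close> in \<open>B\<close> along the isomorphism
  \<open>C \<cong> B/A\<close>, under which \<open>X \<le> C\<close> corresponds to \<open>(A + X)/A\<close>.
\<close>

definition minor_on :: "'v qmat \<Rightarrow> 'v set \<Rightarrow> 'v set \<Rightarrow> 'v set \<Rightarrow> 'v qmat" where
  "minor_on M A B C = (C, \<lambda>X. minor_rank M A B (A + X))"

definition rank_lack :: "'v qmat \<Rightarrow> 'v set \<Rightarrow> int" where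
  "rank_lack M A = snd M (fst M) - snd M A"

definition nullity :: "'v qmat \<Rightarrow> 'v set \<Rightarrow> int" where
  "nullity M A = int (dim A) - snd M A"

text \<open>
  The free product of q-matroids on \<open>E1\<close> and \<open>E2\<close>, meant for \<open>E1 \<inter> E2 = {0}\<close>: the embeddings
  into the direct sum \<open>E1 + E2\<close> are then the inclusions. A q-matroid is determined by its
  independent spaces only on its subspace lattice, whence the condition \<open>extensional\<close>.
\<close>

definition free_product_indep :: "'v qmat \<Rightarrow> 'v qmat \<Rightarrow> 'v set \<Rightarrow> bool" where
  "free_product_indep M1 M2 I \<longleftrightarrow>
     (let I1 = proj (fst M2) (fst M1) ` (I \<inter> fst M1);
          I2 = proj (fst M1) (fst M2) ` I
      in indep M1 I1 \<and> rank_lack M1 I1 \<ge> nullity M2 I2)"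

definition free_product :: "'v qmat \<Rightarrow> 'v qmat \<Rightarrow> 'v qmat" where
  "free_product M1 M2 =
     (let E = fst M1 + fst M2
      in (E, THE r. r \<in> extensional (subspaces E) \<and> qmatroid (E, r) \<and>
                    (\<forall>I\<in>subspaces E. indep (E, r) I \<longleftrightarrow> free_product_indep M1 M2 I)))"

text \<open>
  The product of \<open>M 1, \<dots>, M k\<close> for \<open>k \<ge> 1\<close>, bracketed to the left; the free product is
  associative, so the bracketing is immaterial.
\<close>

definition free_products :: "(nat \<Rightarrow> 'v qmat) \<Rightarrow> nat \<Rightarrow> 'v qmat" where
  "free_products M k = foldl free_product (M 1) (map M [2..<k + 1])"

fun weak_map :: "'v qmat \<Rightarrow> 'v qmat \<Rightarrow> ('v set \<Rightarrow> 'v set) \<Rightarrow> bool" where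
  "weak_map (E1, r1) (E2, r2) \<tau> \<longleftrightarrow>
     \<tau> \<in> subspaces E1 \<rightarrow> subspaces E2 \<and> (\<forall>X\<in>subspaces E1. r1 X \<ge> r2 (\<tau> X))"

end

end

theory Submission
  imports Defs
begin

text \<open>
  The free product of \<open>(E1, r1)\<close> and \<open>(E2, r2)\<close> has the rank function
  \<open>min (r1 E1 + r2 (\<pi>2 X)) (r1 (X \<inter> E1) + dim (\<pi>2 X))\<close>: this function satisfies the q-matroid axioms,
  its independent spaces are the prescribed ones, and a q-matroid is determined by its independent
  spaces. The theorem then follows by induction along the chain: if \<open>r\<close> is dominated on the
  subspaces of \<open>V j\<close> by the rank function \<open>s\<close> of the product of the first \<open>j\<close> minors, then
  \<open>s (V j) + r (V j + X) - r (V j) \<ge> r (V j + X) \<ge> r X\<close>, and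
  \<open>s (X \<inter> V j) + dim X - dim (X \<inter> V j) \<ge> r X\<close> because nullity is monotone.
\<close>

context fq_space
begin

subsection \<open>Dimension of finite-dimensional subspaces\<close>

text \<open>The ambient space may be infinite-dimensional, and \<open>dim\<close> of an
  infinite-dimensional subspace is 0, so even monotonicity of \<open>dim\<close> needs a finiteness
  condition. Containment in a finite span passes to arbitrary subsets at once.\<close>

definition fin_dim :: "'v set \<Rightarrow> bool" where
  "fin_dim A \<longleftrightarrow> (\<exists>B. finite B \<and> A \<subseteq> span B)"

lemma fin_dim_subset: "fin_dim B \<Longrightarrow> A \<subseteq> B \<Longrightarrow> fin_dim A"
  unfolding fin_dim_def by blast

lemma subspace_set_plus:
  assumes "subspace A" "subspace B"
  shows "subspace (A + B)"
proof -
  have "A + B = {x + y |x y. x \<in> A \<and> y \<in> B}" by (auto simp: set_plus_def)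
  then show ?thesis using subspace_sums[OF assms] by simp
qed

lemma set_plus_superset:
  assumes "subspace A" "subspace B"
  shows "A \<subseteq> A + B" "B \<subseteq> A + B"
  using set_zero_plus2[of A B] set_zero_plus2[of B A] subspace_0 assms
  by (auto simp: add.commute)

lemma set_plus_least:
  assumes "subspace C" "A \<subseteq> C" "B \<subseteq> C"
  shows "A + B \<subseteq> C"
  using assms by (auto elim!: set_plus_elim intro: subspace_add)

lemma fin_dim_set_plus:
  assumes "fin_dim A" "fin_dim B"
  shows "fin_dim (A + B)"
proof -
  obtain S T where ST: "finite S" "finite T" "A \<subseteq> span S" "B \<subseteq> span T"
    using assms unfolding fin_dim_def by blast
  have "A + B \<subseteq> span (S \<union> T)"
    using ST(3,4) span_mono[of S "S \<union> T"] span_mono[of T "S \<union> T"]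
    by (intro set_plus_least) auto
  then show ?thesis unfolding fin_dim_def using ST by (meson finite_UnI)
qed

lemma fin_dim_basis:
  assumes "fin_dim A"
  obtains B where "B \<subseteq> A" "independent B" "A \<subseteq> span B" "card B = dim A" "finite B"
proof -
  obtain B where B: "B \<subseteq> A" "independent B" "A \<subseteq> span B" "card B = dim A"
    using basis_exists[of A] .
  obtain S where "finite S" "A \<subseteq> span S" using assms unfolding fin_dim_def by blast
  then have "finite B" using independent_span_bound[of S B] B by auto
  then show ?thesis using B that by blast
qed

lemma dim_mono_fin: "fin_dim B \<Longrightarrow> A \<subseteq> B \<Longrightarrow> dim A \<le> dim B"
  by (metis dim_le_card fin_dim_basis subset_trans)

lemma independent_Un_disjoint_spans:
  assumes "independent A" "independent B" "span A \<inter> span B = {0}"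
  shows "independent (A \<union> B)"
proof -
  \<comment> \<open>The argument treats the two sets asymmetrically, hence the generic
    \<open>S\<close> and \<open>T\<close>: if \<open>a = x + y\<close> with \<open>x\<close> from
    the rest of \<open>S\<close> and \<open>y\<close> from \<open>span T\<close>, then
    \<open>y = a - x\<close> lies in both spans, so \<open>a = x\<close> contradicts independence of
    \<open>S\<close>.\<close>
  have *: False
    if ind: "independent S" and 0: "span S \<inter> span T = {0}"
      and a: "a \<in> S" "a \<in> span ((S \<union> T) - {a})" for S T a
  proof -
    have "a \<in> span ((S - {a}) \<union> T)"
      using a(2) span_mono[of "(S \<union> T) - {a}" "(S - {a}) \<union> T"] by blast
    then obtain x y where xy: "x \<in> span (S - {a})" "y \<in> span T" "a = x + y"
      unfolding span_Un by blast
    have "x \<in> span S" using xy(1) span_mono[of "S - {a}" S] by blast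
    then have "a - x \<in> span S" using span_diff[OF span_base[OF a(1)]] by blast
    then have "y \<in> span S \<inter> span T" using xy(2,3) by simp
    then have "a = x" using 0 xy(3) by simp
    then show False using ind a(1) xy(1) unfolding dependent_def by blast
  qed
  have "a \<notin> span (A \<union> B - {a})" if "a \<in> A \<union> B" for a
  proof (cases "a \<in> A")
    case True
    then show ?thesis using *[OF assms(1,3)] by blast
  next
    case False
    have "span B \<inter> span A = {0}" using assms(3) by (simp only: Int_commute)
    from *[OF assms(2) this, of a] show ?thesis using False that by (auto simp only: Un_commute)
  qed
  then show ?thesis unfolding dependent_def by blast
qed

text \<open>The coordinates of \<open>x\<close> over \<open>A\<close> and over \<open>B\<close> both
  agree with those over \<open>A \<union> B\<close>, so their common support lies in
  \<open>A \<inter> B\<close> and is empty.\<close>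

lemma span_Int_disjoint:
  assumes "independent (A \<union> B)" "A \<inter> B = {}"
  shows "span A \<inter> span B = {0}"
proof -
  have "x = 0" if "x \<in> span A" "x \<in> span B" for x
  proof -
    have indA: "independent A" using assms(1) independent_mono by blast
    have "representation A x = representation B x"
      using representation_extend[OF assms(1), of x A] representation_extend[OF assms(1), of x B] that
      by auto
    then have "{v. representation A x v \<noteq> 0} = {}"
      using representation_ne_zero[of A x] representation_ne_zero[of B x] assms(2) by fastforce
    then show ?thesis
      using sum_nonzero_representation_eq[OF indA that(1)] by (metis sum.empty)
  qed
  then show ?thesis using span_zero by auto
qed

lemma dim_direct_sum:
  assumes "subspace A" "subspace B" "fin_dim A" "fin_dim B" "A \<inter> B = {0}"
  shows "dim (A + B) = dim A + dim B"
proof -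
  obtain S where S: "S \<subseteq> A" "independent S" "A \<subseteq> span S" "card S = dim A" "finite S"
    using fin_dim_basis[OF assms(3)] .
  obtain T where T: "T \<subseteq> B" "independent T" "B \<subseteq> span T" "card T = dim B" "finite T"
    using fin_dim_basis[OF assms(4)] .
  have sp: "span S = A" "span T = B"
    using S T assms span_minimal by blast+
  have ind: "independent (S \<union> T)"
    using independent_Un_disjoint_spans S T sp assms by metis
  have "0 \<notin> S" using S(2) dependent_zero by blast
  then have "S \<inter> T = {}" using S(1) T(1) assms(5) by (metis IntI disjoint_iff singletonD subsetD)
  then have "card (S \<union> T) = dim A + dim B" using S T card_Un_disjoint by metis
  moreover have "span (S \<union> T) = A + B"
    unfolding span_Un sp by (auto simp: set_plus_def)
  ultimately show ?thesis using ind dim_span_eq_card_independent by metis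
qed

text \<open>A basis of \<open>A\<close> is extended to one of \<open>B\<close>; the added vectors
  span the complement. No finiteness enters.\<close>

lemma complement_exists:
  assumes "subspace A" "subspace B" "A \<subseteq> B"
  obtains F where "subspace F" "A + F = B" "A \<inter> F = {0}"
proof -
  obtain S where S: "S \<subseteq> A" "independent S" "A \<subseteq> span S"
    using maximal_independent_subset[of A] .
  obtain T where T: "S \<subseteq> T" "T \<subseteq> B" "independent T" "B \<subseteq> span T"
    using maximal_independent_subset_extend[of S B] S assms by blast
  have sp: "span S = A" "span T = B"
    using S T assms span_minimal by blast+
  have eq: "S \<union> (T - S) = T" using T by blast
  have "A + span (T - S) = B"
    using span_Un[of S "T - S"] unfolding eq sp by (auto simp: set_plus_def)
  moreover have "A \<inter> span (T - S) = {0}"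
    using span_Int_disjoint[of S "T - S"] T(3) eq sp by auto
  ultimately show ?thesis using that[of "span (T - S)"] by simp
qed

text \<open>A complement \<open>F\<close> of \<open>A \<inter> B\<close> in \<open>B\<close> is also
  a complement of \<open>A\<close> in \<open>A + B\<close>; counting both direct sums eliminates
  \<open>dim F\<close>.\<close>

lemma dim_set_plus_Int:
  assumes "subspace A" "subspace B" "fin_dim A" "fin_dim B"
  shows "dim (A + B) + dim (A \<inter> B) = dim A + dim B"
proof -
  obtain F where F: "subspace F" "(A \<inter> B) + F = B" "(A \<inter> B) \<inter> F = {0}"
    using complement_exists[of "A \<inter> B" B] assms subspace_Int by (metis inf_le2 subspace_inter)
  have I: "subspace (A \<inter> B)" using assms subspace_inter by blast
  have FB: "F \<subseteq> B" using F(2) set_plus_superset[OF I F(1)] by simp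
  have AF: "A \<subseteq> A + F" "F \<subseteq> A + F" using set_plus_superset[OF assms(1) F(1)] .
  have sub: "subspace (A + F)" using subspace_set_plus assms(1) F(1) .
  have "A \<inter> B \<subseteq> A + F" using AF(1) by blast
  then have "(A \<inter> B) + F \<subseteq> A + F" using set_plus_least[OF sub] AF(2) by blast
  then have "A + B \<subseteq> A + F" using set_plus_least[OF sub AF(1)] F(2) by simp
  moreover have "A + F \<subseteq> A + B" using set_plus_mono2[OF subset_refl FB] .
  ultimately have "A + F = A + B" by blast
  moreover have "A \<inter> F = {0}" using F FB by blast
  ultimately have "dim (A + B) = dim A + dim F"
    using dim_direct_sum[of A F] assms F fin_dim_subset FB by metis
  moreover have "dim B = dim (A \<inter> B) + dim F"
    using dim_direct_sum[of "A \<inter> B" F] assms F fin_dim_subset FB subspace_inter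
    by (metis inf_le2)
  ultimately show ?thesis by simp
qed

subsection \<open>Rank functions of q-matroids\<close>

lemma subspaces_iff: "A \<in> subspaces E \<longleftrightarrow> subspace A \<and> A \<subseteq> E"
  by (simp add: subspaces_def)

lemma subspaces_Int: "A \<in> subspaces E \<Longrightarrow> B \<in> subspaces E \<Longrightarrow> A \<inter> B \<in> subspaces E"
  by (auto simp: subspaces_iff subspace_inter)

lemma subspaces_set_plus:
  "subspace E \<Longrightarrow> A \<in> subspaces E \<Longrightarrow> B \<in> subspaces E \<Longrightarrow> A + B \<in> subspaces E"
  by (simp add: subspaces_iff subspace_set_plus set_plus_least)

lemma dim_zero_space: "dim {0} = 0"
  by (metis dim_span_eq_card_independent independent_empty span_empty card.empty)

lemma qmatroidI:
  assumes "subspace E" "fin_dim E"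
    and "\<And>A. A \<in> subspaces E \<Longrightarrow> 0 \<le> r A" "\<And>A. A \<in> subspaces E \<Longrightarrow> r A \<le> int (dim A)"
    and "\<And>A B. A \<in> subspaces E \<Longrightarrow> B \<in> subspaces E \<Longrightarrow> A \<subseteq> B \<Longrightarrow> r A \<le> r B"
    and "\<And>A B. A \<in> subspaces E \<Longrightarrow> B \<in> subspaces E \<Longrightarrow> r (A + B) + r (A \<inter> B) \<le> r A + r B"
  shows "qmatroid (E, r)"
proof -
  have "\<exists>B. finite B \<and> span B = E"
    using fin_dim_basis[OF assms(2)] span_minimal[OF _ assms(1)] by (metis subset_antisym)
  then show ?thesis using assms by simp
qed

lemma qmatroid_carrier:
  assumes "qmatroid (E, r)"
  shows "subspace E" "fin_dim E"
  using assms unfolding fin_dim_def by auto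

lemma qmatroid_rank:
  assumes "qmatroid (E, r)" "A \<in> subspaces E"
  shows "0 \<le> r A" "r A \<le> int (dim A)" "fin_dim A" "subspace A" "A \<subseteq> E"
    "B \<in> subspaces E \<Longrightarrow> A \<subseteq> B \<Longrightarrow> r A \<le> r B"
    "B \<in> subspaces E \<Longrightarrow> r (A + B) + r (A \<inter> B) \<le> r A + r B"
  using assms qmatroid_carrier[OF assms(1)] fin_dim_subset by (auto simp: subspaces_iff)

text \<open>\<open>free_product\<close> selects its rank function among the extensional ones, so a
  candidate given by a formula must first be truncated.\<close>

lemma qmatroid_restrict:
  assumes "qmatroid (E, r)"
  shows "qmatroid (E, restrict r (subspaces E))"
proof (rule qmatroidI)
  fix A B assume "A \<in> subspaces E" "B \<in> subspaces E"
  moreover from this have "A + B \<in> subspaces E" "A \<inter> B \<in> subspaces E"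
    using subspaces_set_plus qmatroid_carrier(1)[OF assms] subspaces_Int by blast+
  ultimately show "restrict r (subspaces E) (A + B) + restrict r (subspaces E) (A \<inter> B)
      \<le> restrict r (subspaces E) A + restrict r (subspaces E) B"
    using qmatroid_rank(7)[OF assms, of A B] by simp
qed (use qmatroid_carrier[OF assms] qmatroid_rank[OF assms] in auto)

lemma zero_in_subspaces: "subspace E \<Longrightarrow> {0} \<in> subspaces E"
  by (simp add: subspaces_iff subspace_single_0 subspace_0)

lemma qmatroid_rank_zero: "qmatroid (E, r) \<Longrightarrow> r {0} = 0"
  using qmatroid_rank(1,2)[of E r "{0}"] zero_in_subspaces qmatroid_carrier(1) dim_zero_space
  by fastforce

text \<open>For a complement \<open>F\<close> of \<open>A\<close> in \<open>B\<close>, submodularity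
  and \<open>r {0} = 0\<close> give \<open>r B \<le> r A + r F \<le> r A + dim F\<close>: rank grows
  no faster than dimension.\<close>

lemma qmatroid_nullity_mono:
  assumes "qmatroid (E, r)" "A \<in> subspaces E" "B \<in> subspaces E" "A \<subseteq> B"
  shows "int (dim A) - r A \<le> int (dim B) - r B"
proof -
  note A = qmatroid_rank[OF assms(1,2)] and B = qmatroid_rank[OF assms(1,3)]
  obtain F where F: "subspace F" "A + F = B" "A \<inter> F = {0}"
    using complement_exists A(4) B(4) assms(4) by metis
  have FB: "F \<subseteq> B" using F A set_plus_superset by blast
  then have FE: "F \<in> subspaces E" using F B(5) by (auto simp: subspaces_iff)
  have "dim B = dim A + dim F"
    using dim_direct_sum[of A F] F A B FB fin_dim_subset by metis
  moreover have "r B + r {0} \<le> r A + r F" using A(7)[OF FE] F by simp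
  moreover have "r F \<le> int (dim F)" using qmatroid_rank(2)[OF assms(1) FE] .
  ultimately show ?thesis using qmatroid_rank_zero[OF assms(1)] by simp
qed

section \<open>Independent spaces determine the rank function\<close>

lemma dim_span_singleton_le: "dim (span {x}) \<le> 1"
  using dim_le_card[of "span {x}" "{x}"] by simp

text \<open>Take \<open>I\<close> independent in \<open>A\<close> of maximal dimension. No single
  vector of \<open>A\<close> raises the rank of \<open>I\<close>, and submodularity extends this to
  finite sets, in particular to a basis of \<open>A\<close>.\<close>

lemma qmatroid_indep_same_rank:
  assumes M: "qmatroid (E, r)" and A: "A \<in> subspaces E"
  obtains I where "indep (E, r) I" "I \<subseteq> A" "r I = r A"
proof -
  note E = qmatroid_carrier[OF M] and A' = qmatroid_rank[OF M A]
  let ?P = "\<lambda>I. indep (E, r) I \<and> I \<subseteq> A"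
  have "?P {0}"
    using zero_in_subspaces E qmatroid_rank_zero[OF M] dim_zero_space subspace_0 A' by auto
  moreover have "\<forall>I. ?P I \<longrightarrow> dim I \<le> dim A"
    using dim_mono_fin A' by blast
  then have "\<forall>I. ?P I \<longrightarrow> dim I < Suc (dim A)" by (simp add: less_Suc_eq_le)
  ultimately obtain I where I: "?P I" and max: "\<forall>J. ?P J \<longrightarrow> dim J \<le> dim I"
    using ex_has_greatest_nat[of ?P "{0}" dim "Suc (dim A)"] by blast
  have IE: "I \<in> subspaces E" and rI: "r I = int (dim I)" using I by auto
  note I' = qmatroid_rank[OF M IE]
  \<comment> \<open>A rise in rank is at least 1, while the dimension rises by at most 1 and bounds
    the rank; so \<open>I + span {x}\<close> would be independent and larger than
    \<open>I\<close>.\<close>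
  have step: "r (I + span {x}) \<le> r I" if x: "x \<in> A" for x
  proof (rule ccontr)
    assume "\<not> ?thesis"
    moreover have sx: "span {x} \<subseteq> A" using x A' span_minimal by simp
    then have sxE: "span {x} \<in> subspaces E" using A' by (auto simp: subspaces_iff)
    have JE: "I + span {x} \<in> subspaces E" using subspaces_set_plus E IE sxE by blast
    have "dim (I + span {x}) \<le> dim I + 1"
      using dim_set_plus_Int[of I "span {x}"] I' qmatroid_rank[OF M sxE] dim_span_singleton_le[of x]
      by linarith
    moreover have "r (I + span {x}) \<le> int (dim (I + span {x}))" using qmatroid_rank(2)[OF M JE] .
    ultimately have "r (I + span {x}) = int (dim (I + span {x}))" "dim (I + span {x}) > dim I"
      using rI by linarith+
    moreover have "I + span {x} \<subseteq> A" using I sx A' set_plus_least by blast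
    ultimately show False using max JE by (metis indep.simps not_le)
  qed
  have all: "r (I + span S) \<le> r I" if "finite S" "S \<subseteq> A" for S
    using that
  proof (induction S)
    case empty
    then show ?case by simp
  next
    case (insert x S)
    \<comment> \<open>Both \<open>?X\<close> and \<open>?S\<close> have rank at most
      \<open>r I\<close> and their intersection contains \<open>I\<close>, so submodularity bounds
      the rank of \<open>?X + ?S\<close> by \<open>r I\<close> again.\<close>
    let ?X = "I + span {x}" and ?S = "I + span S"
    have "span S \<subseteq> E" "span {x} \<subseteq> E"
      using insert.prems A' E span_minimal by (meson subset_trans insert_subset empty_subsetI)+
    then have XE: "?X \<in> subspaces E" and SE: "?S \<in> subspaces E"
      using subspaces_set_plus E IE by (simp_all add: subspaces_iff)
    have sub: "I \<subseteq> ?X" "I \<subseteq> ?S" "span {x} \<subseteq> ?X" "span S \<subseteq> ?S"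
      using set_plus_superset I' by auto
    have sumE: "?X + ?S \<in> subspaces E" using subspaces_set_plus E XE SE by blast
    have XS: "?X \<subseteq> ?X + ?S" "?S \<subseteq> ?X + ?S"
      using set_plus_superset XE SE by (auto simp: subspaces_iff)
    have "insert x S \<subseteq> ?X + ?S"
      using sub XS span_base[of x "{x}"] span_superset[of S] by blast
    then have "span (insert x S) \<subseteq> ?X + ?S"
      using span_minimal sumE by (simp add: subspaces_iff)
    then have "I + span (insert x S) \<subseteq> ?X + ?S"
      using sub XS sumE set_plus_least by (metis subset_trans subspaces_iff)
    moreover have "I + span (insert x S) \<in> subspaces E"
      using insert.prems A' E IE span_minimal[of "insert x S" E]
      by (intro subspaces_set_plus) (auto simp: subspaces_iff)
    ultimately have "r (I + span (insert x S)) \<le> r (?X + ?S)"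
      using qmatroid_rank(6)[OF M] sumE by blast
    also have "\<dots> \<le> r ?X + r ?S - r (?X \<inter> ?S)" using qmatroid_rank(7)[OF M XE SE] by simp
    also have "\<dots> \<le> r ?X + r ?S - r I"
      using I'(6)[OF subspaces_Int[OF XE SE]] sub by simp
    also have "\<dots> \<le> r I" using insert step by fastforce
    finally show ?case .
  qed
  obtain S where S: "S \<subseteq> A" "A \<subseteq> span S" "finite S"
    using fin_dim_basis[OF A'(3)] by metis
  have sS: "span S = A" using S A' span_minimal by blast
  then have "I + span S = A"
    using set_plus_superset(2)[of I A] set_plus_least[of A I A] A' I I' by auto
  then have "r A \<le> r I" using all[OF S(3,1)] by simp
  then show ?thesis using that I I'(6)[OF A] by force
qed

text \<open>An independent subspace of \<open>A\<close> that attains \<open>r A\<close> keeps its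
  rank under \<open>r'\<close>. Applied in both directions, this yields uniqueness of the rank
  function in \<open>free_product\<close>.\<close>

lemma qmatroid_rank_le_if_indep:
  assumes M: "qmatroid (E, r)" and M': "qmatroid (E, r')"
    and ind: "\<And>I. I \<in> subspaces E \<Longrightarrow> indep (E, r) I \<Longrightarrow> indep (E, r') I"
    and A: "A \<in> subspaces E"
  shows "r A \<le> r' A"
proof -
  obtain I where I: "indep (E, r) I" "I \<subseteq> A" "r I = r A"
    using qmatroid_indep_same_rank[OF M A] .
  then have IE: "I \<in> subspaces E" and "r' I = r A" using ind[of I] by auto
  then show ?thesis using qmatroid_rank(6)[OF M' IE A I(2)] by simp
qed

subsection \<open>The rank function of a free product\<close>

lemma proj_eqI:
  assumes "subspace A" "subspace B" "A \<inter> B = {0}" "b \<in> B" "x - b \<in> A"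
  shows "proj A B x = b"
  unfolding proj_def
proof (rule the_equality)
  fix c assume c: "c \<in> B \<and> x - c \<in> A"
  have "(x - b) - (x - c) \<in> A" "c - b \<in> B"
    using c assms by (blast intro: subspace_diff)+
  then have "c - b \<in> A \<inter> B" by simp
  then show "c = b" using assms(3) by simp
qed (use assms in simp)

lemma proj_image:
  assumes "subspace A" "subspace B" "A \<inter> B = {0}" "X \<subseteq> A + B"
  shows "proj A B ` X = (A + X) \<inter> B"
proof (intro equalityI subsetI)
  fix y assume "y \<in> proj A B ` X"
  then obtain x where x: "x \<in> X" "y = proj A B x" by blast
  obtain a b where ab: "a \<in> A" "b \<in> B" "x = a + b" using x assms(4) by (blast elim: set_plus_elim)
  have "y = b" using proj_eqI[OF assms(1-3) ab(2)] ab x by simp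
  moreover have "- a + x \<in> A + X" using ab x assms(1) subspace_neg by blast
  ultimately show "y \<in> (A + X) \<inter> B" using ab by simp
next
  fix y assume "y \<in> (A + X) \<inter> B"
  then obtain a x where *: "a \<in> A" "x \<in> X" "y = a + x" "y \<in> B" by (blast elim: set_plus_elim)
  then have "x - y \<in> A" using assms(1) subspace_neg by simp
  then show "y \<in> proj A B ` X" using proj_eqI[OF assms(1-3) *(4)] *(2) by (metis image_eqI)
qed

lemma proj_image_inside:
  assumes "subspace A" "subspace B" "A \<inter> B = {0}" "X \<subseteq> B"
  shows "proj A B ` X = X"
proof -
  have "proj A B x = x" if "x \<in> X" for x
    using proj_eqI[OF assms(1-3), of x x] that assms(4) subspace_0[OF assms(1)] by auto
  then show ?thesis by simp
qed

context
  fixes E1 E2 :: "'v set" and r1 r2 :: "'v set \<Rightarrow> int"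
  assumes M1: "qmatroid (E1, r1)" and M2: "qmatroid (E2, r2)" and disj: "E1 \<inter> E2 = {0}"
begin

text \<open>For \<open>X \<subseteq> E1 + E2\<close> this is the image of \<open>X\<close> under the
  projection onto \<open>E2\<close> along \<open>E1\<close>, by \<open>proj_image\<close>.\<close>

abbreviation (input) proj2 :: "'v set \<Rightarrow> 'v set" where
  "proj2 X \<equiv> (E1 + X) \<inter> E2"

text \<open>Any q-matroid on \<open>E1 + E2\<close> that restricts to the first factor on
  \<open>E1\<close> and contracts by \<open>E1\<close> to the second obeys both bounds: the first
  term is the rank of \<open>E1 + X\<close>, the second adds the codimension of
  \<open>X \<inter> E1\<close> in \<open>X\<close> to its rank.\<close>

definition product_rank :: "'v set \<Rightarrow> int" where
  "product_rank X = min (r1 E1 + r2 (proj2 X)) (r1 (X \<inter> E1) + int (dim (proj2 X)))"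

lemmas E1 = qmatroid_carrier[OF M1]
lemmas E2 = qmatroid_carrier[OF M2]

section \<open>Intersections with \<open>E1\<close> and projections to \<open>E2\<close>\<close>

lemma proj2_subspaces: "X \<in> subspaces (E1 + E2) \<Longrightarrow> proj2 X \<in> subspaces E2"
  using E1 E2 by (auto simp: subspaces_iff intro: subspace_inter subspace_set_plus)

lemma Int_subspaces: "X \<in> subspaces (E1 + E2) \<Longrightarrow> X \<inter> E1 \<in> subspaces E1"
  using E1 by (auto simp: subspaces_iff intro: subspace_inter)

lemma carrier_subspaces: "E1 \<in> subspaces E1"
  using E1 by (simp add: subspaces_iff)

lemma plus_carrier: "subspace (E1 + E2)" "fin_dim (E1 + E2)"
  using E1 E2 subspace_set_plus fin_dim_set_plus by auto

lemma proj2_decomp: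
  assumes "X \<subseteq> E1 + E2" "x \<in> X"
  obtains e y where "e \<in> E1" "y \<in> proj2 X" "x = e + y"
proof -
  obtain e y where *: "e \<in> E1" "y \<in> E2" "x = e + y" using assms by (blast elim: set_plus_elim)
  then have "y = - e + x" by simp
  then have "y \<in> E1 + X" using *(1) assms(2) subspace_neg[OF E1(1)] by blast
  then show ?thesis using * that by blast
qed

lemma plus_proj2:
  assumes "X \<in> subspaces (E1 + E2)"
  shows "E1 + proj2 X = E1 + X"
proof
  have X: "subspace X" "X \<subseteq> E1 + E2" using assms by (auto simp: subspaces_iff)
  have P: "subspace (proj2 X)" using proj2_subspaces[OF assms] by (simp add: subspaces_iff)
  show "E1 + proj2 X \<subseteq> E1 + X"
    using set_plus_superset[OF E1(1) X(1)]
    by (intro set_plus_least subspace_set_plus E1(1) X(1)) auto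
  have "X \<subseteq> E1 + proj2 X"
    using proj2_decomp[OF X(2)] by (metis set_plus_intro subsetI)
  then show "E1 + X \<subseteq> E1 + proj2 X"
    using set_plus_superset[OF E1(1) P] by (intro set_plus_least subspace_set_plus E1(1) P) auto
qed

text \<open>This is rank-nullity for the projection to \<open>E2\<close>, whose kernel on
  \<open>X\<close> is \<open>X \<inter> E1\<close>. It follows from computing
  \<open>dim (E1 + X)\<close> twice, since \<open>E1 + X\<close> is the direct sum of
  \<open>E1\<close> and \<open>proj2 X\<close>.\<close>

lemma dim_Int_proj2:
  assumes "X \<in> subspaces (E1 + E2)"
  shows "dim X = dim (X \<inter> E1) + dim (proj2 X)"
proof -
  have X: "subspace X" "fin_dim X"
    using assms plus_carrier fin_dim_subset by (auto simp: subspaces_iff)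
  note P = qmatroid_rank[OF M2 proj2_subspaces[OF assms]]
  have "E1 \<inter> proj2 X = {0}"
    using disj subspace_0[OF P(4)] by blast
  then have "dim (E1 + proj2 X) = dim E1 + dim (proj2 X)"
    using dim_direct_sum[OF E1(1) P(4) E1(2) P(3)] by blast
  moreover have "dim (E1 + X) + dim (E1 \<inter> X) = dim E1 + dim X"
    using dim_set_plus_Int[OF E1(1) X(1) E1(2) X(2)] .
  ultimately show ?thesis unfolding plus_proj2[OF assms] by (simp add: Int_commute)
qed

lemma proj2_mono: "X \<subseteq> Y \<Longrightarrow> proj2 X \<subseteq> proj2 Y"
  using set_plus_mono2[of E1 E1 X Y] by blast

lemma proj2_set_plus:
  assumes X: "X \<in> subspaces (E1 + E2)" and Y: "Y \<in> subspaces (E1 + E2)"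
  shows "proj2 (X + Y) = proj2 X + proj2 Y"
proof
  note P = proj2_subspaces[OF X, unfolded subspaces_iff] proj2_subspaces[OF Y, unfolded subspaces_iff]
  have XY: "X + Y \<in> subspaces (E1 + E2)" using subspaces_set_plus plus_carrier X Y by blast
  have "subspace (proj2 (X + Y))" using proj2_subspaces[OF XY] by (simp add: subspaces_iff)
  then show "proj2 X + proj2 Y \<subseteq> proj2 (X + Y)"
    using proj2_mono[of X "X + Y"] proj2_mono[of Y "X + Y"] set_plus_superset[of X Y] X Y
    by (intro set_plus_least) (simp_all add: subspaces_iff)
  show "proj2 (X + Y) \<subseteq> proj2 X + proj2 Y"
  proof
    fix z assume z: "z \<in> proj2 (X + Y)"
    then obtain e x y where exy: "e \<in> E1" "x \<in> X" "y \<in> Y" "z = e + (x + y)"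
      by (blast elim: set_plus_elim)
    obtain a x' where x': "a \<in> E1" "x' \<in> proj2 X" "x = a + x'"
      using proj2_decomp[of X x] X exy by (auto simp: subspaces_iff)
    obtain b y' where y': "b \<in> E1" "y' \<in> proj2 Y" "y = b + y'"
      using proj2_decomp[of Y y] Y exy by (auto simp: subspaces_iff)
    \<comment> \<open>The two sides lie in \<open>E2\<close> and in \<open>E1\<close> respectively,
      so both vanish.\<close>
    have eq: "z - (x' + y') = e + (a + b)" using exy x' y' by (simp add: algebra_simps)
    moreover have "e + (a + b) \<in> E1" using exy x' y' E1 subspace_add by blast
    moreover have "z - (x' + y') \<in> E2"
      using z x' y' E2 by (blast intro: subspace_diff subspace_add)
    ultimately have "z - (x' + y') = 0" using disj by auto
    then show "z \<in> proj2 X + proj2 Y" using x' y' by auto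
  qed
qed

text \<open>Bound \<open>X + Y\<close> by the first term and \<open>X \<inter> Y\<close> by the
  second. Submodularity of \<open>r2\<close> leaves the nullity of
  \<open>proj2 X \<inter> proj2 Y\<close>, which is at most that of \<open>proj2 Y\<close>.\<close>

lemma product_rank_submodular_mixed:
  assumes X: "X \<in> subspaces (E1 + E2)" and Y: "Y \<in> subspaces (E1 + E2)"
  shows "product_rank (X + Y) + product_rank (X \<inter> Y)
    \<le> (r1 E1 + r2 (proj2 X)) + (r1 (Y \<inter> E1) + int (dim (proj2 Y)))"
proof -
  have XY: "X \<inter> Y \<in> subspaces (E1 + E2)" using subspaces_Int X Y .
  note PX = proj2_subspaces[OF X] and PY = proj2_subspaces[OF Y]
  note PI = subspaces_Int[OF PX PY]
  have "r2 (proj2 (X + Y)) + r2 (proj2 X \<inter> proj2 Y) \<le> r2 (proj2 X) + r2 (proj2 Y)"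
    unfolding proj2_set_plus[OF X Y] using qmatroid_rank(7)[OF M2 PX PY] .
  moreover have "int (dim (proj2 X \<inter> proj2 Y)) - r2 (proj2 X \<inter> proj2 Y)
      \<le> int (dim (proj2 Y)) - r2 (proj2 Y)"
    using qmatroid_nullity_mono[OF M2 PI PY] by blast
  moreover have "dim (proj2 (X \<inter> Y)) \<le> dim (proj2 X \<inter> proj2 Y)"
    using dim_mono_fin[OF qmatroid_rank(3)[OF M2 PI]] proj2_mono[of "X \<inter> Y"] by simp
  moreover have "r1 (X \<inter> Y \<inter> E1) \<le> r1 (Y \<inter> E1)"
    using qmatroid_rank(6)[OF M1 Int_subspaces[OF XY] Int_subspaces[OF Y]] by blast
  moreover have "product_rank (X + Y) \<le> r1 E1 + r2 (proj2 (X + Y))"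
    "product_rank (X \<inter> Y) \<le> r1 (X \<inter> Y \<inter> E1) + int (dim (proj2 (X \<inter> Y)))"
    unfolding product_rank_def by simp_all
  ultimately show ?thesis by linarith
qed

text \<open>Projection commutes with sums but only sends \<open>X \<inter> Y\<close> into the
  intersection of the images; monotonicity of \<open>r2\<close> absorbs the difference.\<close>

lemma product_rank_submodular_first:
  assumes X: "X \<in> subspaces (E1 + E2)" and Y: "Y \<in> subspaces (E1 + E2)"
  shows "product_rank (X + Y) + product_rank (X \<inter> Y)
    \<le> (r1 E1 + r2 (proj2 X)) + (r1 E1 + r2 (proj2 Y))"
proof -
  have XY: "X \<inter> Y \<in> subspaces (E1 + E2)" using subspaces_Int X Y .
  note PX = proj2_subspaces[OF X] and PY = proj2_subspaces[OF Y] and PXY = proj2_subspaces[OF XY]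
  have "r2 (proj2 (X + Y)) + r2 (proj2 X \<inter> proj2 Y) \<le> r2 (proj2 X) + r2 (proj2 Y)"
    unfolding proj2_set_plus[OF X Y] using qmatroid_rank(7)[OF M2 PX PY] .
  moreover have "r2 (proj2 (X \<inter> Y)) \<le> r2 (proj2 X \<inter> proj2 Y)"
    using qmatroid_rank(6)[OF M2 PXY subspaces_Int[OF PX PY]] proj2_mono[of "X \<inter> Y"] by simp
  moreover have "product_rank (X + Y) \<le> r1 E1 + r2 (proj2 (X + Y))"
    "product_rank (X \<inter> Y) \<le> r1 E1 + r2 (proj2 (X \<inter> Y))"
    unfolding product_rank_def by simp_all
  ultimately show ?thesis by linarith
qed

text \<open>
  Since \<open>r1 (X \<inter> E1) + dim (\<pi>2 X)\<close> is \<open>dim X\<close> minus the nullity of \<open>X \<inter> E1\<close>, its submodularity comes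
  from the modularity of \<open>dim\<close> and from the nullity being supermodular and monotone.
\<close>

lemma product_rank_submodular_second:
  assumes X: "X \<in> subspaces (E1 + E2)" and Y: "Y \<in> subspaces (E1 + E2)"
  shows "product_rank (X + Y) + product_rank (X \<inter> Y)
    \<le> (r1 (X \<inter> E1) + int (dim (proj2 X))) + (r1 (Y \<inter> E1) + int (dim (proj2 Y)))"
proof -
  have XY: "X \<inter> Y \<in> subspaces (E1 + E2)" using subspaces_Int X Y .
  have S: "X + Y \<in> subspaces (E1 + E2)" using subspaces_set_plus plus_carrier X Y by blast
  have fin: "subspace X" "subspace Y" "fin_dim X" "fin_dim Y"
    using X Y plus_carrier fin_dim_subset by (auto simp: subspaces_iff)
  let ?P = "X \<inter> E1" and ?Q = "Y \<inter> E1"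
  note P = Int_subspaces[OF X] and Q = Int_subspaces[OF Y]
  have PQ: "?P + ?Q \<in> subspaces E1" using subspaces_set_plus E1 P Q by blast
  have eq: "?P \<inter> ?Q = X \<inter> Y \<inter> E1" by blast
  \<comment> \<open>This inclusion can be proper; monotonicity of the nullity bridges the
    gap.\<close>
  have "?P + ?Q \<subseteq> (X + Y) \<inter> E1"
    using set_plus_superset[OF fin(1,2)] Int_subspaces[OF S]
    by (intro set_plus_least) (auto simp: subspaces_iff intro: subspace_inter subspace_set_plus fin E1)
  then have "int (dim (?P + ?Q)) - r1 (?P + ?Q) \<le> int (dim ((X + Y) \<inter> E1)) - r1 ((X + Y) \<inter> E1)"
    using qmatroid_nullity_mono[OF M1 PQ Int_subspaces[OF S]] by blast
  moreover have "r1 (?P + ?Q) + r1 (X \<inter> Y \<inter> E1) \<le> r1 ?P + r1 ?Q"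
    using qmatroid_rank(7)[OF M1 P Q] eq by simp
  moreover have "dim (?P + ?Q) + dim (X \<inter> Y \<inter> E1) = dim ?P + dim ?Q"
    using dim_set_plus_Int[of ?P ?Q] qmatroid_rank[OF M1 P] qmatroid_rank[OF M1 Q] eq by simp
  moreover have "dim (X + Y) + dim (X \<inter> Y) = dim X + dim Y"
    using dim_set_plus_Int fin by blast
  moreover note dim_Int_proj2[OF X] dim_Int_proj2[OF Y] dim_Int_proj2[OF S] dim_Int_proj2[OF XY]
  moreover have "product_rank (X + Y) \<le> r1 ((X + Y) \<inter> E1) + int (dim (proj2 (X + Y)))"
    "product_rank (X \<inter> Y) \<le> r1 (X \<inter> Y \<inter> E1) + int (dim (proj2 (X \<inter> Y)))"
    unfolding product_rank_def by simp_all
  ultimately show ?thesis by linarith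
qed

lemma qmatroid_product_rank: "qmatroid (E1 + E2, product_rank)"
proof (rule qmatroidI)
  show "subspace (E1 + E2)" "fin_dim (E1 + E2)" by (fact plus_carrier)+
next
  fix X assume X: "X \<in> subspaces (E1 + E2)"
  note P = qmatroid_rank[OF M2 proj2_subspaces[OF X]] and I = qmatroid_rank[OF M1 Int_subspaces[OF X]]
  show "0 \<le> product_rank X"
    unfolding product_rank_def using P(1) I(1) qmatroid_rank(1)[OF M1 carrier_subspaces] by simp
  show "product_rank X \<le> int (dim X)"
    unfolding product_rank_def dim_Int_proj2[OF X] using I(2) by simp
  fix Y assume Y: "Y \<in> subspaces (E1 + E2)"
  show "product_rank X \<le> product_rank Y" if "X \<subseteq> Y"
  proof -
    note PY = qmatroid_rank[OF M2 proj2_subspaces[OF Y]]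
    have "r2 (proj2 X) \<le> r2 (proj2 Y)" "dim (proj2 X) \<le> dim (proj2 Y)" "r1 (X \<inter> E1) \<le> r1 (Y \<inter> E1)"
      using P(6)[OF proj2_subspaces[OF Y]] dim_mono_fin[OF PY(3)] proj2_mono[OF that]
        I(6)[OF Int_subspaces[OF Y]] that by blast+
    then show ?thesis unfolding product_rank_def by linarith
  qed
  \<comment> \<open>There are four cases, by which term attains the minimum at \<open>X\<close> and
    at \<open>Y\<close>; the mixed bound is used in both orders.\<close>
  show "product_rank (X + Y) + product_rank (X \<inter> Y) \<le> product_rank X + product_rank Y"
    using product_rank_submodular_first[OF X Y] product_rank_submodular_second[OF X Y] product_rank_submodular_mixed[OF X Y]
      product_rank_submodular_mixed[OF Y X]
    unfolding product_rank_def[of X] product_rank_def[of Y]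
    by (simp add: min_def add.commute[of Y] Int_commute[of Y] split: if_splits)
qed

text \<open>The rank equals \<open>dim X = dim (X \<inter> E1) + dim (proj2 X)\<close> iff both
  terms reach it. For the second this says that \<open>X \<inter> E1\<close> is independent; given
  that, for the first it is the inequality between rank lack and nullity.\<close>

lemma indep_product_rank:
  assumes X: "X \<in> subspaces (E1 + E2)"
  shows "indep (E1 + E2, product_rank) X \<longleftrightarrow> free_product_indep (E1, r1) (E2, r2) X"
proof -
  have "E2 \<inter> E1 = {0}" using disj by blast
  then have "proj E2 E1 ` (X \<inter> E1) = X \<inter> E1"
    by (rule proj_image_inside[OF E2(1) E1(1)]) simp
  moreover have "proj E1 E2 ` X = proj2 X"
    using proj_image[OF E1(1) E2(1) disj] X by (simp add: subspaces_iff)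
  ultimately show ?thesis
    using X Int_subspaces[OF X] qmatroid_rank(2)[OF M1 Int_subspaces[OF X]] dim_Int_proj2[OF X]
    unfolding free_product_indep_def rank_lack_def nullity_def product_rank_def
    by (auto simp: Let_def min_def)
qed

text \<open>This resolves the definite description: the truncated \<open>product_rank\<close> is a
  witness, and a rival with the same independent spaces has the same rank on every subspace.\<close>

lemma free_product_eq:
  "free_product (E1, r1) (E2, r2) = (E1 + E2, restrict product_rank (subspaces (E1 + E2)))"
proof -
  let ?S = "subspaces (E1 + E2)"
  let ?r = "restrict product_rank ?S"
  let ?P = "\<lambda>r. r \<in> extensional ?S \<and> qmatroid (E1 + E2, r) \<and>
    (\<forall>I\<in>?S. indep (E1 + E2, r) I \<longleftrightarrow> free_product_indep (E1, r1) (E2, r2) I)"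
  have q: "qmatroid (E1 + E2, ?r)"
    using qmatroid_restrict[OF qmatroid_product_rank] .
  have ind: "indep (E1 + E2, ?r) I \<longleftrightarrow> free_product_indep (E1, r1) (E2, r2) I" if "I \<in> ?S" for I
    using indep_product_rank[OF that] that by simp
  have "(THE r. ?P r) = ?r"
  proof (rule the_equality)
    show "?P ?r" by (intro conjI ballI restrict_extensional q ind)
  next
    fix r assume r: "?P r"
    have r': "r \<in> extensional ?S" "qmatroid (E1 + E2, r)"
      by (rule conjunct1[OF r], rule conjunct1[OF conjunct2[OF r]])
    have eq: "indep (E1 + E2, r) I \<longleftrightarrow> indep (E1 + E2, ?r) I" if I: "I \<in> ?S" for I
      unfolding ind[OF I] by (rule bspec[OF conjunct2[OF conjunct2[OF r]] I])
    show "r = ?r"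
    proof (rule extensionalityI[OF r'(1) restrict_extensional])
      fix X assume X: "X \<in> ?S"
      have "r X \<le> ?r X" "?r X \<le> r X"
        by (rule qmatroid_rank_le_if_indep[OF r'(2) q _ X], simp only: eq)
          (rule qmatroid_rank_le_if_indep[OF q r'(2) _ X], simp only: eq)
      then show "r X = ?r X" by (rule antisym)
    qed
  qed
  then show ?thesis unfolding free_product_def by (simp add: Let_def)
qed

end

subsection \<open>Minors along a chain\<close>

text \<open>\<open>minor_rank\<close> is meaningful only on the interval from \<open>V\<close> to
  \<open>W\<close>; the translate \<open>V + X\<close> of a subspace of the complement lies
  there.\<close>

lemma minor_on_eq:
  assumes "minor_on (E, r) V W C = (C', s)"
  shows "C' = C" and "direct_sum W V C \<Longrightarrow> X \<in> subspaces C \<Longrightarrow> s X = r (V + X) - r V"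
proof -
  show "C' = C" using assms by (simp add: minor_on_def)
  assume W: "direct_sum W V C" and X: "X \<in> subspaces C"
  then have "V + X \<in> subspaces W" "V \<subseteq> V + X"
    using set_plus_superset[of V X] set_plus_mono2[of V V X C]
    by (auto simp: direct_sum_def subspaces_iff subspace_set_plus)
  then show "s X = r (V + X) - r V" using assms by (auto simp: minor_on_def)
qed

lemma qmatroid_minor_on:
  assumes M: "qmatroid (E, r)" and W: "W \<in> subspaces E" and ds: "direct_sum W V C"
  shows "qmatroid (minor_on (E, r) V W C)"
proof -
  obtain C' s where ms: "minor_on (E, r) V W C = (C', s)" by fastforce
  note s = minor_on_eq(2)[OF ms ds]
  have sub: "subspace V" "subspace C" "V \<inter> C = {0}" "W = V + C"
    using ds by (auto simp: direct_sum_def)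
  have VE: "V \<in> subspaces E" and CE: "C \<in> subspaces E"
    using set_plus_superset[OF sub(1,2)] W sub by (auto simp: subspaces_iff)
  have E: "subspace E" using qmatroid_carrier[OF M] by blast
  note V = qmatroid_rank[OF M VE]
  have XE: "X \<in> subspaces E" "V + X \<in> subspaces E" "V \<subseteq> V + X" if "X \<in> subspaces C" for X
    using that CE subspaces_set_plus[OF E VE, of X] set_plus_superset[OF sub(1), of X]
    by (auto simp: subspaces_iff)
  have "qmatroid (C, s)"
  proof (rule qmatroidI)
    show "subspace C" "fin_dim C" using sub qmatroid_rank[OF M CE] by auto
    fix X assume X: "X \<in> subspaces C"
    note XE' = XE[OF X]
    show "0 \<le> s X" using s[OF X] V(6)[OF XE'(2,3)] by simp
    \<comment> \<open>As \<open>r (V \<inter> X)\<close> is nonnegative, the relative rank of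
      \<open>X\<close> is at most \<open>r X\<close>, hence at most \<open>dim X\<close>.\<close>
    have "r (V + X) + r (V \<inter> X) \<le> r V + r X" using V(7)[OF XE'(1)] .
    then show "s X \<le> int (dim X)"
      using s[OF X] qmatroid_rank(2)[OF M XE'(1)] qmatroid_rank(1)[OF M subspaces_Int[OF VE XE'(1)]]
      by simp
    fix Y assume Y: "Y \<in> subspaces C"
    note YE = XE[OF Y]
    show "s X \<le> s Y" if "X \<subseteq> Y"
      using s[OF X] s[OF Y] qmatroid_rank(6)[OF M XE'(2) YE(2)] set_plus_mono2[of V V X Y] that
      by simp
    have XY: "X \<inter> Y \<in> subspaces C" "X + Y \<in> subspaces C"
      using subspaces_Int subspaces_set_plus sub X Y by auto
    have "V + V = V"
      using set_plus_superset[OF sub(1,1)] set_plus_least[OF sub(1), of V V] by blast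
    moreover have "(V + X) + (V + Y) = (V + V) + (X + Y)" by (simp only: ac_simps)
    ultimately have eq: "(V + X) + (V + Y) = V + (X + Y)" by simp
    \<comment> \<open>One inclusion suffices, since \<open>r\<close> is monotone and the
      intersection occurs on the smaller side of submodularity.\<close>
    have "V + (X \<inter> Y) \<subseteq> (V + X) \<inter> (V + Y)"
      using set_plus_mono2[of V V] by blast
    then have "r (V + (X \<inter> Y)) \<le> r ((V + X) \<inter> (V + Y))"
      using qmatroid_rank(6)[OF M XE(2)[OF XY(1)] subspaces_Int[OF XE'(2) YE(2)]] by blast
    then show "s (X + Y) + s (X \<inter> Y) \<le> s X + s Y"
      using s[OF X] s[OF Y] s[OF XY(1)] s[OF XY(2)] qmatroid_rank(7)[OF M XE'(2) YE(2)] eq by simp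
  qed
  then show ?thesis using ms minor_on_eq(1)[OF ms] by simp
qed

lemma free_products_Suc:
  "j \<ge> 1 \<Longrightarrow> free_products M (Suc j) = free_product (free_products M j) (M (Suc j))"
  by (simp add: free_products_def upt_Suc)

text \<open>The induction also carries the carrier and the q-matroid axioms of the partial product,
  because \<open>free_product_eq\<close> needs them of its left factor.\<close>

lemma free_products_dominates:
  assumes M: "qmatroid (E, r)" and j: "1 \<le> j" "j \<le> k"
    and V0: "V 0 = {0}" and V: "\<And>i. i \<le> k \<Longrightarrow> V i \<in> subspaces E"
    and ds: "\<And>i. i \<in> {1..k} \<Longrightarrow> direct_sum (V i) (V (i - 1)) (C i)"
    and N: "\<And>i. i \<in> {1..k} \<Longrightarrow> N i = minor_on (E, r) (V (i - 1)) (V i) (C i)"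
  shows "\<exists>s. free_products N j = (V j, s) \<and> qmatroid (V j, s) \<and>
    (\<forall>X\<in>subspaces (V j). r X \<le> s X)"
  using j
proof (induction j rule: dec_induct)
  case base
  have 1: "1 \<in> {1..k}" using base by simp
  obtain C' s where ms: "minor_on (E, r) (V 0) (V 1) (C 1) = (C', s)" by fastforce
  have d: "direct_sum (V 1) (V 0) (C 1)" using ds[OF 1] by simp
  \<comment> \<open>As \<open>V 0\<close> is zero, the first complement is all of
    \<open>V 1\<close>, and the first minor is the restriction of \<open>r\<close> to it.\<close>
  then have CV: "C 1 = V 1" using V0 by (simp add: direct_sum_def)
  have fp: "free_products N 1 = (V 1, s)"
    using N[OF 1] ms minor_on_eq(1)[OF ms] CV by (simp add: free_products_def)
  have "qmatroid (V 1, s)"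
    using qmatroid_minor_on[OF M V d] base ms minor_on_eq(1)[OF ms] CV by simp
  moreover have "r X \<le> s X" if "X \<in> subspaces (V 1)" for X
    using minor_on_eq(2)[OF ms d, of X] that CV V0 qmatroid_rank_zero[OF M] by simp
  ultimately show ?case using fp by blast
next
  case (step j)
  have j: "j \<ge> 1" "j \<le> k" "Suc j \<in> {1..k}" using step by auto
  obtain s where s: "free_products N j = (V j, s)" "qmatroid (V j, s)"
    "\<And>X. X \<in> subspaces (V j) \<Longrightarrow> r X \<le> s X"
    using step.IH j by blast
  let ?C = "C (Suc j)"
  obtain C' t where ms: "minor_on (E, r) (V j) (V (Suc j)) ?C = (C', t)" by fastforce
  have d: "direct_sum (V (Suc j)) (V j) ?C" using ds[OF j(3)] by simp
  then have disj: "V j \<inter> ?C = {0}" and sum: "V j + ?C = V (Suc j)" by (auto simp: direct_sum_def)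
  have VS: "V (Suc j) \<in> subspaces E" "V j \<in> subspaces E" using V j by auto
  have t: "N (Suc j) = (?C, t)" "qmatroid (?C, t)"
    using N[OF j(3)] ms minor_on_eq(1)[OF ms] qmatroid_minor_on[OF M VS(1) d] by auto
  let ?\<rho> = "product_rank (V j) ?C s t"
  have fp: "free_products N (Suc j) = (V (Suc j), restrict ?\<rho> (subspaces (V (Suc j))))"
    unfolding free_products_Suc[OF j(1)] s(1) t(1) free_product_eq[OF s(2) t(2) disj] sum ..
  have q: "qmatroid (V (Suc j), ?\<rho>)"
    using qmatroid_product_rank[OF s(2) t(2) disj] sum by simp
  have "qmatroid (V (Suc j), restrict ?\<rho> (subspaces (V (Suc j))))"
    using qmatroid_restrict[OF q] .
  moreover have "r X \<le> ?\<rho> X" if X: "X \<in> subspaces (V (Suc j))" for X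
  proof -
    have X': "X \<in> subspaces (V j + ?C)" using X sum by simp
    let ?P = "(V j + X) \<inter> ?C"
    have XE: "X \<in> subspaces E" using X VS by (auto simp: subspaces_iff)
    have PC: "?P \<in> subspaces ?C" using proj2_subspaces[OF s(2) t(2) disj X'] .
    have VX: "V j + X \<in> subspaces E" "X \<subseteq> V j + X"
      using subspaces_set_plus VS XE qmatroid_carrier[OF M] set_plus_superset(2)[of "V j" X]
      by (auto simp: subspaces_iff)
    \<comment> \<open>\<open>V j + ?P\<close> equals \<open>V j + X\<close>, so the minor sees the
      rank of \<open>V j + X\<close> relative to \<open>V j\<close>.\<close>
    have "t ?P = r (V j + X) - r (V j)"
      using minor_on_eq(2)[OF ms d PC] plus_proj2[OF s(2) t(2) disj X'] by simp
    moreover have "r X \<le> r (V j + X)" using qmatroid_rank(6)[OF M XE VX] .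
    moreover have "r (V j) \<le> s (V j)" using s(3) VS by (simp add: subspaces_iff)
    ultimately have 1: "r X \<le> s (V j) + t ?P" by simp
    have IV: "X \<inter> V j \<in> subspaces (V j)" using Int_subspaces[OF s(2) t(2) disj X'] .
    have IE: "X \<inter> V j \<in> subspaces E" using subspaces_Int XE VS by blast
    have "int (dim (X \<inter> V j)) - r (X \<inter> V j) \<le> int (dim X) - r X"
      using qmatroid_nullity_mono[OF M IE XE] by simp
    \<comment> \<open>Here \<open>dim ?P\<close> is the codimension of \<open>X \<inter> V j\<close>
      in \<open>X\<close>.\<close>
    then have "r X \<le> s (X \<inter> V j) + int (dim ?P)"
      using s(3)[OF IV] dim_Int_proj2[OF s(2) t(2) disj X'] by simp
    with 1 show ?thesis unfolding product_rank_def[OF s(2) t(2) disj] by simp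
  qed
  ultimately show ?case using fp
    by (intro exI[where x = "restrict ?\<rho> (subspaces (V (Suc j)))"])
      (simp del: qmatroid.simps add: restrict_def)
qed

end

theorem theorem4p12:
  fixes scale :: "'f::{field,finite} \<Rightarrow> 'v::ab_group_add \<Rightarrow> 'v"
    and E :: "'v set" and r :: "'v set \<Rightarrow> int"
    and V C :: "nat \<Rightarrow> 'v set" and k :: nat
    and M :: "nat \<Rightarrow> 'v qmat"
  assumes "fq_space scale"
    and "fq_space.qmatroid scale (E, r)"
    and "k \<ge> 1"
    and "V 0 = {0}" and "V k = E"
    and "\<forall>i\<le>k. V i \<in> fq_space.subspaces scale E"
    and "\<forall>i\<in>{1..k}. V (i - 1) \<subset> V i"
    and "\<forall>i\<in>{1..k}. fq_space.direct_sum scale (V i) (V (i - 1)) (C i)"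
    and "\<forall>i\<in>{1..k}. M i = fq_space.minor_on scale (E, r) (V (i - 1)) (V i) (C i)"
  shows "fq_space.weak_map scale (fq_space.free_products scale M k) (E, r) id \<and>
    (\<forall>X\<in>fq_space.subspaces scale E. snd (fq_space.free_products scale M k) X \<ge> r X)"
proof -
  interpret fq_space scale by (fact assms(1))
  have V: "\<And>i. i \<le> k \<Longrightarrow> V i \<in> subspaces E"
    and C: "\<And>i. i \<in> {1..k} \<Longrightarrow> direct_sum (V i) (V (i - 1)) (C i)"
    and M: "\<And>i. i \<in> {1..k} \<Longrightarrow> M i = minor_on (E, r) (V (i - 1)) (V i) (C i)"
    using assms(6,8,9) by blast+
  \<comment> \<open>At \<open>j = k\<close> the carrier is \<open>V k = E\<close>, so the domination
    gives both conjuncts.\<close>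
  have "\<exists>s. free_products M k = (V k, s) \<and> qmatroid (V k, s) \<and> (\<forall>X\<in>subspaces (V k). r X \<le> s X)"
    by (rule free_products_dominates[of E r k k V C M, OF assms(2,3) order.refl assms(4) V C M])
  then show ?thesis using assms(5) by auto
qed

end
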